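(* If $G$ is a connected graph whose longest path has length $p$, then $c(G) \leq \lceil\frac{2p}{3}\rceil+3$.
   Context: The length of a path is its number of vertices. Cops and Robbers is played on a connected graph: first the cops are placed on vertices, then the robber chooses a vertex; players alternate turns (cops first), each cop/robber moving to an adjacent vertex or staying put; the cops win if a cop eventually moves onto the robber's vertex. The cop number $c(G)$ is the least number of cops guaranteeing a cop win regardless of the robber's strategy. *)

theory Defs
  imports
    Complex_Main
    "HOL-Library.Extended_Nat"
    "Graph_Theory.Digraph_Component"
    "Graph_Theory.Vertex_Walk"
begin

text \<open>
  An undirected edge is a pair of opposite arcs. Finiteness is not required, in contrast to
  the locale \<^locale>\<open>graph\<close>.
\<close>

locale simple_graph = sym_digraph + loopfree_digraph + nomulti_digraph

text \<open>
  Paths are vertex lists without repetition, and their length is the number of vertices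
  (\<^const>\<open>length\<close>, not \<^const>\<open>vwalk_length\<close>).
\<close>

definition longest_path :: "'a list \<Rightarrow> ('a, 'b) pre_digraph \<Rightarrow> bool" where
  "longest_path P G \<longleftrightarrow> vpath P G \<and> (\<forall>Q. vpath Q G \<longrightarrow> length Q \<le> length P)"

definition legal_move :: "('a, 'b) pre_digraph \<Rightarrow> 'a \<Rightarrow> 'a \<Rightarrow> bool" where
  "legal_move G u v \<longleftrightarrow> u \<in> verts G \<and> (v = u \<or> u \<rightarrow>\<^bsub>G\<^esub> v)"

definition robber_play :: "('a, 'b) pre_digraph \<Rightarrow> (nat \<Rightarrow> 'a) \<Rightarrow> bool" where
  "robber_play G r \<longleftrightarrow> r 0 \<in> verts G \<and> (\<forall>t. legal_move G (r t) (r (Suc t)))"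

text \<open>
  A strategy \<open>\<sigma>\<close> for \<open>k\<close> cops maps the list of robber positions so far (oldest first) to the
  positions \<open>\<sigma> h 0, \<dots>, \<sigma> h (k - 1)\<close> of the cops; their own past positions are determined by \<open>\<sigma>\<close>.
  The order of events is: placement \<open>\<sigma> []\<close>, robber chooses \<open>r 0\<close>, cops move to \<open>\<sigma> [r 0]\<close>, robber
  moves to \<open>r 1\<close>, cops move to \<open>\<sigma> [r 0, r 1]\<close>, and so on. Several cops may share a vertex.
\<close>

definition cop_strategy ::
    "('a, 'b) pre_digraph \<Rightarrow> nat \<Rightarrow> ('a list \<Rightarrow> nat \<Rightarrow> 'a) \<Rightarrow> bool" where
  "cop_strategy G k \<sigma> \<longleftrightarrow>
     (\<forall>i<k. \<sigma> [] i \<in> verts G) \<and>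
     (\<forall>r t. robber_play G r \<longrightarrow>
        (\<forall>i<k. legal_move G (\<sigma> (map r [0..<t]) i) (\<sigma> (map r [0..<Suc t]) i)))"

text \<open>
  The robber sees the cops, but every robber strategy against a fixed \<open>\<sigma>\<close> produces a
  single robber play and every robber play arises in this way, so it suffices to quantify
  over plays.
\<close>

definition winning_cop_strategy ::
    "('a, 'b) pre_digraph \<Rightarrow> nat \<Rightarrow> ('a list \<Rightarrow> nat \<Rightarrow> 'a) \<Rightarrow> bool" where
  "winning_cop_strategy G k \<sigma> \<longleftrightarrow>
     cop_strategy G k \<sigma> \<and>
     (\<forall>r. robber_play G r \<longrightarrow> (\<exists>t. \<exists>i<k. \<sigma> (map r [0..<Suc t]) i = r t))"

text \<open>The value is \<open>\<infinity>\<close> if no finite number of cops suffices.\<close>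

definition cop_number :: "('a, 'b) pre_digraph \<Rightarrow> enat" where
  "cop_number G = (INF k\<in>{k. \<exists>\<sigma>. winning_cop_strategy G k \<sigma>}. enat k)"

end

(*
  The cops grow a path v_1, v_2, ... of G such that the robber is confined to the component of
  G - {v_1, ..., v_m} which is adjacent to v_m. A cop standing on v_(2i+1) also controls its
  neighbour v_(2i+2): if the robber moves there, he is caught at once. Hence one cop per two path
  vertices suffices, and since the path cannot have more than p vertices, (p + 1) div 2 cops win.
*)
theory Submission
  imports Defs
begin

text \<open>Take for \<open>y\<close> the vertex after the last visit to \<open>x\<close>: from
  there on the walk avoids \<open>x\<close> as well as \<open>S\<close>. This extends the path by
  one vertex while the robber stays reachable from its new end.\<close>

lemma rtrancl_leave_start:
  assumes "(x, r) \<in> (A \<inter> (- S) \<times> (- S))\<^sup>*" "r \<noteq> x"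
  obtains y where "(x, y) \<in> A" "y \<notin> insert x S"
    "(y, r) \<in> (A \<inter> (- insert x S) \<times> (- insert x S))\<^sup>*"
proof -
  have "r \<noteq> x \<longrightarrow> (\<exists>y. (x, y) \<in> A \<and> y \<notin> insert x S \<and>
      (y, r) \<in> (A \<inter> (- insert x S) \<times> (- insert x S))\<^sup>*)"
    using assms(1)
  proof induction
    case (step r r')
    show ?case
    proof (cases "r' = x \<or> r = x")
      case True
      then show ?thesis using step.hyps by auto
    next
      case False
      then have "(r, r') \<in> A \<inter> (- insert x S) \<times> (- insert x S)"
        using step.hyps by auto
      then show ?thesis
        using step.IH False by (meson rtrancl.rtrancl_into_rtrancl)
    qed
  qed simp
  then show ?thesis using assms(2) that by blast
qed

lemma rtrancl_avoiding_target:
  assumes "(x, r) \<in> (A \<inter> (- S) \<times> (- S))\<^sup>*" "x \<notin> S"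
  shows "r \<notin> S"
  using assms by induction auto

subsection \<open>Winning positions\<close>

text \<open>Positions with the cops to move.\<close>

inductive cop_win :: "('a, 'b) pre_digraph \<Rightarrow> nat \<Rightarrow> (nat \<Rightarrow> 'a) \<Rightarrow> 'a \<Rightarrow> bool"
  for G k where
  catch: "i < k \<Longrightarrow> legal_move G (c i) r \<Longrightarrow> r \<in> verts G \<Longrightarrow> (\<forall>j<k. c j \<in> verts G)
    \<Longrightarrow> cop_win G k c r"
| move: "(\<forall>i<k. legal_move G (c i) (c' i)) \<Longrightarrow> (\<And>r'. legal_move G r r' \<Longrightarrow> cop_win G k c' r')
    \<Longrightarrow> cop_win G k c r"

text \<open>Legality and capture are demanded only along plays starting at \<open>r0\<close>, so
  strategies for different robber positions can be glued by a case distinction on the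
  history.\<close>

definition wins_from ::
    "('a, 'b) pre_digraph \<Rightarrow> nat \<Rightarrow> ('a list \<Rightarrow> nat \<Rightarrow> 'a) \<Rightarrow> 'a \<Rightarrow> bool" where
  "wins_from G k \<sigma> r0 \<longleftrightarrow>
     (\<forall>r. robber_play G r \<longrightarrow> r 0 = r0 \<longrightarrow>
        (\<forall>t. \<forall>i<k. legal_move G (\<sigma> (map r [0..<t]) i) (\<sigma> (map r [0..<Suc t]) i)) \<and>
        (\<exists>t. \<exists>i<k. \<sigma> (map r [0..<Suc t]) i = r t))"

lemma map_upt_Suc_shift: "map r [0..<Suc t] = r 0 # map (\<lambda>s. r (Suc s)) [0..<t]"
  by (induction t) auto

text \<open>A derivation of \<open>cop_win\<close> is a well-founded game tree; rule induction
  assembles a history-based strategy from those of the subtrees, one for each robber reply.\<close>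

lemma cop_win_imp_strategy:
  assumes "cop_win G k c r0"
  shows "\<exists>\<sigma>. \<sigma> [] = c \<and> wins_from G k \<sigma> r0"
  using assms
proof induction
  case (catch i c r0)
  \<comment> \<open>After the capture the cops stand still forever. Staying put is legal only on
    vertices of \<open>G\<close>, whence the vertex premises of \<open>catch\<close>.\<close>
  define \<sigma> where "\<sigma> h = (if h = [] then c else c(i := r0))" for h :: "'a list"
  have "wins_from G k \<sigma> r0"
    unfolding wins_from_def
  proof (intro allI impI conjI)
    fix r t j
    assume "j < k"
    then show "legal_move G (\<sigma> (map r [0..<t]) j) (\<sigma> (map r [0..<Suc t]) j)"
      using catch by (auto simp: \<sigma>_def legal_move_def)
  next
    fix r :: "nat \<Rightarrow> 'a"
    assume "r 0 = r0"
    then have "\<sigma> (map r [0..<Suc 0]) i = r 0"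
      by (simp add: \<sigma>_def)
    then show "\<exists>t. \<exists>i<k. \<sigma> (map r [0..<Suc t]) i = r t"
      using catch by blast
  qed
  moreover have "\<sigma> [] = c"
    by (simp add: \<sigma>_def)
  ultimately show ?case by blast
next
  case (move c c' r0)
  then have "\<forall>r'. \<exists>\<tau>. legal_move G r0 r' \<longrightarrow> \<tau> [] = c' \<and> wins_from G k \<tau> r'"
    by blast
  from choice[OF this]
  obtain \<tau> where \<tau>: "\<And>r'. legal_move G r0 r' \<Longrightarrow> \<tau> r' [] = c' \<and> wins_from G k (\<tau> r') r'"
    by blast
  \<comment> \<open>The first answer is \<open>c'\<close>; afterwards the oldest robber position is
    dropped and the strategy chosen for his reply \<open>r'\<close> takes over. The pieces fit
    because \<open>\<tau> r' [] = c'\<close>.\<close>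
  define \<sigma> where "\<sigma> h = (case h of [] \<Rightarrow> c | [_] \<Rightarrow> c' | _ # r' # h' \<Rightarrow> \<tau> r' (r' # h'))" for h
  have "wins_from G k \<sigma> r0"
    unfolding wins_from_def
  proof (intro allI impI)
    fix r assume r: "robber_play G r" "r 0 = r0"
    define q where "q s = r (Suc s)" for s
    have moves: "legal_move G (q t) (q (Suc t))" for t
      using r by (simp add: robber_play_def q_def)
    moreover have "q 0 \<in> verts G"
      using moves[of 0] by (simp add: legal_move_def)
    moreover have "legal_move G r0 (q 0)"
      using r by (auto simp: robber_play_def q_def)
    ultimately have q: "robber_play G q" "legal_move G r0 (q 0)"
      by (simp_all add: robber_play_def)
    have shift: "\<sigma> (map r [0..<Suc t]) = \<tau> (q 0) (map q [0..<t])" for t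
    proof (cases t)
      case 0
      then show ?thesis using \<tau>[OF q(2)] by (simp add: \<sigma>_def)
    next
      case (Suc s)
      then show ?thesis
        unfolding map_upt_Suc_shift[of r] q_def[symmetric]
        by (simp only: map_upt_Suc_shift \<sigma>_def list.case)
    qed
    have wins: "wins_from G k (\<tau> (q 0)) (q 0)"
      using \<tau>[OF q(2)] by simp
    show "(\<forall>t. \<forall>i<k. legal_move G (\<sigma> (map r [0..<t]) i) (\<sigma> (map r [0..<Suc t]) i)) \<and>
        (\<exists>t. \<exists>i<k. \<sigma> (map r [0..<Suc t]) i = r t)"
    proof (intro conjI allI impI)
      fix t i assume "i < k"
      show "legal_move G (\<sigma> (map r [0..<t]) i) (\<sigma> (map r [0..<Suc t]) i)"
      proof (cases t)
        case 0
        then show ?thesis using move.hyps \<open>i < k\<close> by (simp add: \<sigma>_def)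
      next
        case (Suc s)
        then show ?thesis
          unfolding Suc shift using wins q(1) \<open>i < k\<close> by (simp only: wins_from_def)
      qed
    next
      obtain t i where "i < k" "\<tau> (q 0) (map q [0..<Suc t]) i = q t"
        using wins q(1) unfolding wins_from_def by blast
      then show "\<exists>t. \<exists>i<k. \<sigma> (map r [0..<Suc t]) i = r t"
        by (metis shift q_def)
    qed
  qed
  moreover have "\<sigma> [] = c"
    by (simp add: \<sigma>_def)
  ultimately show ?case by blast
qed

text \<open>The strategies for the various starting vertices of the robber share the placement
  \<open>c\<close>, so the first entry of the history can select among them.\<close>

lemma cop_number_le_if_cop_win:
  assumes c: "\<And>i. i < k \<Longrightarrow> c i \<in> verts G"
    and win: "\<And>r. r \<in> verts G \<Longrightarrow> cop_win G k c r"
  shows "cop_number G \<le> enat k"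
proof -
  have "\<exists>\<tau>. r \<in> verts G \<longrightarrow> \<tau> [] = c \<and> wins_from G k \<tau> r" for r
    using cop_win_imp_strategy[OF win[of r]] by (cases "r \<in> verts G") simp_all
  then have "\<forall>r. \<exists>\<tau>. r \<in> verts G \<longrightarrow> \<tau> [] = c \<and> wins_from G k \<tau> r"
    by (rule allI)
  from choice[OF this]
  obtain \<tau> where \<tau>: "\<And>r. r \<in> verts G \<Longrightarrow> \<tau> r [] = c \<and> wins_from G k (\<tau> r) r"
    by blast
  define \<sigma> where "\<sigma> h = (case h of [] \<Rightarrow> c | r # _ \<Rightarrow> \<tau> r h)" for h
  have \<sigma>: "\<sigma> (map r [0..<t]) = \<tau> (r 0) (map r [0..<t])" if "robber_play G r" for r t
    using that \<tau>[of "r 0"]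
    by (cases t) (simp_all only: \<sigma>_def robber_play_def map_upt_Suc_shift upt_0 list.map list.case)
  have wins: "wins_from G k (\<tau> (r 0)) (r 0)" if "robber_play G r" for r
    using that \<tau>[of "r 0"] by (simp add: robber_play_def)
  have "winning_cop_strategy G k \<sigma>"
    unfolding winning_cop_strategy_def cop_strategy_def
  proof (intro conjI allI impI)
    show "\<sigma> [] i \<in> verts G" if "i < k" for i
      using c[OF that] by (simp add: \<sigma>_def)
  next
    fix r t i assume "robber_play G r" "i < k"
    then show "legal_move G (\<sigma> (map r [0..<t]) i) (\<sigma> (map r [0..<Suc t]) i)"
      using wins[of r] by (simp only: \<sigma> wins_from_def)
  next
    fix r assume "robber_play G r"
    then show "\<exists>t. \<exists>i<k. \<sigma> (map r [0..<Suc t]) i = r t"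
      using wins[of r] by (simp only: \<sigma> wins_from_def)
  qed
  then show ?thesis
    unfolding cop_number_def by (intro INF_lower) blast
qed

subsection \<open>Confining the robber\<close>

context sym_digraph
begin

text \<open>Cop \<open>j\<close> walks to \<open>x\<close> while the others stand still and guard
  \<open>S\<close>. Since no guard is cop \<open>j\<close>, his walk leaves nothing unguarded, and
  the robber is either caught in \<open>S\<close> or remains in the component of \<open>x\<close> in
  \<open>G - S\<close>.\<close>

lemma cop_win_travel:
  assumes "c j \<rightarrow>\<^sup>* x"
    and "\<And>i. i < k \<Longrightarrow> c i \<in> verts G"
    and "r \<in> verts G" "r \<notin> S"
    and "(x, r) \<in> (arcs_ends G \<inter> (- S) \<times> (- S))\<^sup>*"
    and "\<And>s. s \<in> S \<Longrightarrow> \<exists>i<k. i \<noteq> j \<and> legal_move G (c i) s"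
    and "\<And>r. r \<in> verts G \<Longrightarrow> r \<notin> S
      \<Longrightarrow> (x, r) \<in> (arcs_ends G \<inter> (- S) \<times> (- S))\<^sup>* \<Longrightarrow> cop_win G k (c(j := x)) r"
  shows "cop_win G k c r"
  using assms
proof (induction "c j" arbitrary: c r rule: converse_reachable_induct)
  case base
  then show ?case by (metis fun_upd_triv)
next
  case (step y c r)
  define d where "d = c(j := y)"
  have d: "d i \<in> verts G" if "i < k" for i
    using step.prems(1)[OF that] step.hyps(1) by (auto simp: d_def adj_in_verts)
  have guard: "\<exists>i<k. i \<noteq> j \<and> legal_move G (d i) s" if "s \<in> S" for s
    using step.prems(5)[OF that] by (auto simp: d_def)
  show ?case
  proof (rule cop_win.move[where c' = d])
    show "\<forall>i<k. legal_move G (c i) (d i)"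
      using step.prems(1) step.hyps(1) by (auto simp: d_def legal_move_def)
  next
    fix r' assume r': "legal_move G r r'"
    then have r'_vert: "r' \<in> verts G"
      by (auto simp: legal_move_def adj_in_verts)
    show "cop_win G k d r'"
    proof (cases "r' \<in> S")
      case True
      then show ?thesis
        using guard[OF True] r'_vert d by (blast intro: cop_win.catch)
    next
      case False
      \<comment> \<open>Both ends of the robber's move lie outside \<open>S\<close>, so it does not
        leave the component.\<close>
      have "(x, r') \<in> (arcs_ends G \<inter> (- S) \<times> (- S))\<^sup>*"
        using r' step.prems(3,4) False
        by (auto simp: legal_move_def intro: rtrancl.rtrancl_into_rtrancl)
      moreover have "y = d j" "d(j := x) = c(j := x)"
        by (simp_all add: d_def)
      ultimately show ?thesis
        using step.hyps(3)[of d r'] d r'_vert False guard step.prems(6) by simp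
    qed
  qed
qed

text \<open>The path is stored newest vertex first: \<open>xs\<close> is guarded by the cops below
  \<open>m\<close>, and \<open>x\<close> is the end to be occupied next, by cop \<open>m\<close>.
  Each round lengthens the guarded part by two vertices, which the bound \<open>p\<close> on paths
  allows only finitely often.\<close>

lemma cop_win_along_path:
  assumes reach: "\<And>u v. u \<in> verts G \<Longrightarrow> v \<in> verts G \<Longrightarrow> u \<rightarrow>\<^sup>* v"
    and bound: "\<And>Q. vpath Q G \<Longrightarrow> length Q \<le> p"
    and k: "p \<le> 2 * k"
    and "vpath (x # xs) G" "length xs = 2 * m"
    and "\<And>i. i < k \<Longrightarrow> c i \<in> verts G"
    and "\<And>s. s \<in> set xs \<Longrightarrow> \<exists>i<m. legal_move G (c i) s"
    and "r \<in> verts G" "r \<notin> set xs"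
    and "(x, r) \<in> (arcs_ends G \<inter> (- set xs) \<times> (- set xs))\<^sup>*"
  shows "cop_win G k c r"
  using assms(4-)
proof (induction "p - length xs" arbitrary: x xs m c r rule: less_induct)
  case less
  have path: "vwalk (x # xs) G" "x \<in> verts G" "x \<notin> set xs"
    using less.prems(1) by (auto simp: vpath_def vwalk_def)
  \<comment> \<open>The path \<open>x # xs\<close> has \<open>2 * m + 1\<close> vertices, at most
    \<open>2 * k\<close>, so a free cop remains.\<close>
  have "m < k"
    using bound[OF less.prems(1)] less.prems(2) k by simp
  show ?case
  proof (rule cop_win_travel[where j = m])
    show "c m \<rightarrow>\<^sup>* x"
      using reach less.prems(3) \<open>m < k\<close> path(2) by blast
    show "\<exists>i<k. i \<noteq> m \<and> legal_move G (c i) s" if s: "s \<in> set xs" for s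
    proof -
      obtain i where "i < m" "legal_move G (c i) s"
        using less.prems(4)[OF s] by blast
      then show ?thesis using \<open>m < k\<close> by (intro exI[of _ i]) simp
    qed
    fix r' assume r': "r' \<in> verts G" "r' \<notin> set xs"
      "(x, r') \<in> (arcs_ends G \<inter> (- set xs) \<times> (- set xs))\<^sup>*"
    let ?d = "c(m := x)"
    have d: "?d i \<in> verts G" if "i < k" for i
      using less.prems(3)[OF that] path(2) by simp
    have catch: "cop_win G k ?d s" if "legal_move G x s" "s \<in> verts G" for s
      using that d \<open>m < k\<close> by (intro cop_win.catch[of m]) auto
    show "cop_win G k ?d r'"
    proof (cases "r' = x")
      case True
      then show ?thesis using catch r' by (simp add: legal_move_def)
    next
      case False
      \<comment> \<open>No cop needs to go to \<open>y\<close>: cop \<open>m\<close> on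
        \<open>x\<close> covers it.\<close>
      obtain y where y: "x \<rightarrow>\<^bsub>G\<^esub> y" "y \<notin> insert x (set xs)"
        "(y, r') \<in> (arcs_ends G \<inter> (- insert x (set xs)) \<times> (- insert x (set xs)))\<^sup>*"
        using rtrancl_leave_start[OF r'(3) False] .
      show ?thesis
      proof (cases "r' = y")
        case True
        then show ?thesis using catch r' y path(2) by (simp add: legal_move_def)
      next
        case ry: False
        obtain z where z: "y \<rightarrow>\<^bsub>G\<^esub> z" "z \<notin> insert y (insert x (set xs))"
          "(z, r') \<in> (arcs_ends G \<inter> (- insert y (insert x (set xs)))
             \<times> (- insert y (insert x (set xs))))\<^sup>*"
          using rtrancl_leave_start[OF y(3) ry] .
        have verts: "y \<in> verts G" "z \<in> verts G"
          using y(1) z(1) by (auto simp: adj_in_verts)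
        \<comment> \<open>New vertices are prepended, so the walk traverses the arcs just found
          backwards.\<close>
        have "y \<rightarrow>\<^bsub>G\<^esub> x" "z \<rightarrow>\<^bsub>G\<^esub> y"
          using y(1) z(1) by (auto intro: arcs_ends_symmetric)
        then have "vwalk (z # y # x # xs) G"
          using path(1) verts by (simp add: vwalk_def)
        then have zpath: "vpath (z # y # x # xs) G"
          using less.prems(1) y(2) z(2) by (auto simp: vpath_def)
        \<comment> \<open>The old guards have not moved; cop \<open>m\<close> guards
          \<open>x\<close> by staying and \<open>y\<close> by adjacency.\<close>
        have guard: "\<exists>i<Suc m. legal_move G (?d i) s" if "s \<in> set (y # x # xs)" for s
        proof (cases "s \<in> set xs")
          case True
          then obtain i where "i < m" "legal_move G (c i) s"
            using less.prems(4) by blast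
          then show ?thesis by (intro exI[of _ i]) simp
        next
          case False
          then show ?thesis
            using that y(1) path(2) by (intro exI[of _ m]) (auto simp: legal_move_def)
        qed
        have "r' \<notin> set (y # x # xs)"
          using rtrancl_avoiding_target[OF z(3) z(2)] by simp
        \<comment> \<open>Subtraction is truncated, so the strict decrease needs
          \<open>length xs < p\<close>; the path ending in \<open>z\<close> provides it.\<close>
        moreover have "p - length (y # x # xs) < p - length xs"
          using bound[OF zpath] by simp
        ultimately show ?thesis
          using less.hyps[of "y # x # xs" z "Suc m" ?d r'] zpath less.prems(2) d guard r'(1) z(3)
          by simp
      qed
    qed
  qed (use less.prems in auto)
qed

end

theorem cop_number_le_half_path_bound:
  assumes "sym_digraph G" "Digraph_Component.connected G"
    and bound: "\<And>Q. vpath Q G \<Longrightarrow> length Q \<le> p"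
    and k: "p \<le> 2 * k"
  shows "cop_number G \<le> enat k"
proof -
  interpret sym_digraph G by fact
  \<comment> \<open>\<open>connected\<close> refers to the symmetric closure, whose reachability is
    that of \<open>G\<close> because the arcs are symmetric.\<close>
  have sc: "strongly_connected G"
    using assms(2)
    by (simp add: connected_def strongly_connected_def reachable_mk_symmetric_eq[OF sym_arcs])
  then have reach: "u \<rightarrow>\<^sup>*\<^bsub>G\<^esub> v" if "u \<in> verts G" "v \<in> verts G" for u v
    using that by (auto simp: strongly_connected_def)
  obtain v where v: "v \<in> verts G"
    using sc by (auto simp: strongly_connected_def)
  show ?thesis
  proof (rule cop_number_le_if_cop_win[where c = "\<lambda>_. v"])
    fix r assume r: "r \<in> verts G"
    show "cop_win G k (\<lambda>_. v) r"
      \<comment> \<open>All cops start on \<open>v\<close>, the path is \<open>[v]\<close> and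
        nothing is guarded yet, so the robber's territory is all of \<open>G\<close>.\<close>
      using v r reachable_rtranclI[OF reach[OF v r]]
      by (intro cop_win_along_path[where x = v and xs = "[]" and m = 0 and p = p] reach bound k)
        (auto simp: vpath_def)
  qed (use v in auto)
qed

theorem theorem1p4:
  fixes G :: "('a, 'b) pre_digraph" and P :: "'a list" and p :: nat
  assumes "simple_graph G"
    and "Digraph_Component.connected G"
    and "longest_path P G"
    and "length P = p"
  shows "cop_number G \<le> enat (nat \<lceil>2 * real p / 3\<rceil> + 3)"
proof (rule cop_number_le_half_path_bound)
  show "sym_digraph G"
    using assms(1) by (simp add: simple_graph_def)
  show "length Q \<le> p" if "vpath Q G" for Q
    using assms(3,4) that by (auto simp: longest_path_def)
  \<comment> \<open>If \<open>n\<close> is at least \<open>2p/3\<close>, then \<open>2n\<close> is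
    at least \<open>4p/3\<close>, hence at least \<open>p\<close>.\<close>
  have "p \<le> 2 * (n + 3)" if "2 * real p / 3 \<le> real n" for n
  proof -
    have "real p \<le> real (2 * (n + 3))"
      using that by simp
    then show ?thesis by (simp only: of_nat_le_iff)
  qed
  then show "p \<le> 2 * (nat \<lceil>2 * real p / 3\<rceil> + 3)"
    using real_nat_ceiling_ge by blast
qed fact

end
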